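(* Let $\{\phi_i\}_{i\in I}$ and $\{\psi_i\}_{i\in I}$ be two woven frames for $\mathcal H$, let $\sigma\subset I$, and let $\{\varphi_i\}_{i\in I}$ be an alternate dual frame of the weaving frame $\{\phi_i\}_{i\in\sigma}\cup\{\psi_i\}_{i\in\sigma^c}$. Then for any $\lambda\in\mathbb R$ and all $f\in\mathcal H$, $$\begin{aligned} &\mathrm{Re}\Big(\sum_{i\in\sigma}\langle f,\varphi_i\rangle\overline{\langle f,\phi_i\rangle}\Big)+\Big\|\sum_{i\in\sigma^c}\langle f,\varphi_i\rangle\psi_i\Big\|^2\\ =\ &\mathrm{Re}\Big(\sum_{i\in\sigma^c}\langle f,\varphi_i\rangle\overline{\langle f,\psi_i\rangle}\Big)+\Big\|\sum_{i\in\sigma}\langle f,\varphi_i\rangle\phi_i\Big\|^2\\ \ge\ &(2\lambda-\lambda^2)\,\mathrm{Re}\Big(\sum_{i\in\sigma}\langle f,\varphi_i\rangle\overline{\langle f,\phi_i\rangle}\Big)+(1-\lambda^2)\,\mathrm{Re}\Big(\sum_{i\in\sigma^c}\langle f,\varphi_i\rangle\overline{\langle f,\psi_i\rangle}\Big). \end{aligned}$$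
   Context: $\mathcal H$ is a separable Hilbert space with inner product linear in the first argument, $I$ is a countable index set, and for $\sigma\subset I$ one writes $\sigma^c=I\setminus\sigma$. A family $\{\phi_i\}_{i\in I}$ in $\mathcal H$ is a frame with lower and upper frame bounds $A,B>0$ if $A\|f\|^2\le\sum_{i\in I}|\langle f,\phi_i\rangle|^2\le B\|f\|^2$ for all $f\in\mathcal H$. Two frames $\{\phi_i\}_{i\in I}$ and $\{\psi_i\}_{i\in I}$ for $\mathcal H$ are woven if there are universal constants $A,B>0$ such that for every $\sigma\subset I$ the family $\{\phi_i\}_{i\in\sigma}\cup\{\psi_i\}_{i\in\sigma^c}$ (called a weaving) is a frame for $\mathcal H$ with lower and upper bounds $A$ and $B$. A frame $\{\varphi_i\}_{i\in I}$ for $\mathcal H$ is an alternate dual frame of the weaving $\{\phi_i\}_{i\in\sigma}\cup\{\psi_i\}_{i\in\sigma^c}$ if for all $f\in\mathcal H$, $f=\sum_{i\in\sigma}\langle f,\phi_i\rangle\varphi_i+\sum_{i\in\sigma^c}\langle f,\psi_i\rangle\varphi_i$ (equivalently, $f=\sum_{i\in\sigma}\langle f,\varphi_i\rangle\phi_i+\sum_{i\in\sigma^c}\langle f,\varphi_i\rangle\psi_i$ for all $f\in\mathcal H$). *)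

theory Defs
  imports "HOL-Analysis.Analysis"
begin

text \<open>
  Complex inner product spaces with the inner product linear in the first argument. The norm and
  the real vector space structure are those of the superclass; positive definiteness of the inner
  product is contained in \<open>cinner_self\<close> together with the norm axioms.
\<close>

class complex_inner = real_normed_vector +
  fixes scaleC :: "complex \<Rightarrow> 'a \<Rightarrow> 'a"  (infixr "*\<^sub>C" 75)
    and cinner :: "'a \<Rightarrow> 'a \<Rightarrow> complex"
  assumes scaleC_add_right: "a *\<^sub>C (x + y) = a *\<^sub>C x + a *\<^sub>C y"
    and scaleC_add_left: "(a + b) *\<^sub>C x = a *\<^sub>C x + b *\<^sub>C x"
    and scaleC_scaleC: "a *\<^sub>C (b *\<^sub>C x) = (a * b) *\<^sub>C x"
    and scaleC_of_real: "complex_of_real r *\<^sub>C x = r *\<^sub>R x"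
    and cinner_add_left: "cinner (x + y) z = cinner x z + cinner y z"
    and cinner_scaleC_left: "cinner (a *\<^sub>C x) y = a * cinner x y"
    and cinner_commute: "cinner x y = cnj (cinner y x)"
    and cinner_self: "cinner x x = complex_of_real ((norm x)\<^sup>2)"

class complex_hilbert = complex_inner + complete_space

instantiation complex :: complex_hilbert
begin

definition scaleC_complex :: "complex \<Rightarrow> complex \<Rightarrow> complex"
  where "scaleC_complex a x = a * x"

definition cinner_complex :: "complex \<Rightarrow> complex \<Rightarrow> complex"
  where "cinner_complex x y = x * cnj y"

instance
proof
  fix x :: complex
  show "cinner x x = complex_of_real ((norm x)\<^sup>2)"
    by (simp only: cinner_complex_def complex_norm_square)
qed (simp_all add: scaleC_complex_def cinner_complex_def algebra_simps scaleR_conv_of_real)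

end

text \<open>
  Sums over index sets are unconditional. A real-valued infinite sum that fails to converge is
  assigned the value 0 by the library, hence the explicit summability condition.
\<close>

definition frame_with_bounds ::
    "'i set \<Rightarrow> ('i \<Rightarrow> 'h::complex_hilbert) \<Rightarrow> real \<Rightarrow> real \<Rightarrow> bool"
  where "frame_with_bounds I \<phi> A B \<longleftrightarrow> 0 < A \<and> 0 < B \<and>
    (\<forall>f. (\<lambda>i. (cmod (cinner f (\<phi> i)))\<^sup>2) summable_on I \<and>
         A * (norm f)\<^sup>2 \<le> (\<Sum>\<^sub>\<infinity>i\<in>I. (cmod (cinner f (\<phi> i)))\<^sup>2) \<and>
         (\<Sum>\<^sub>\<infinity>i\<in>I. (cmod (cinner f (\<phi> i)))\<^sup>2) \<le> B * (norm f)\<^sup>2)"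

definition is_frame :: "'i set \<Rightarrow> ('i \<Rightarrow> 'h::complex_hilbert) \<Rightarrow> bool"
  where "is_frame I \<phi> \<longleftrightarrow> (\<exists>A B. frame_with_bounds I \<phi> A B)"

text \<open>
  The union of families in a weaving is a family indexed by \<open>I\<close> (vectors are counted with
  multiplicity), not a union of sets of vectors.
\<close>

definition weaving :: "'i set \<Rightarrow> ('i \<Rightarrow> 'h) \<Rightarrow> ('i \<Rightarrow> 'h) \<Rightarrow> 'i \<Rightarrow> 'h"
  where "weaving \<sigma> \<phi> \<psi> i = (if i \<in> \<sigma> then \<phi> i else \<psi> i)"

definition woven_frames ::
    "'i set \<Rightarrow> ('i \<Rightarrow> 'h::complex_hilbert) \<Rightarrow> ('i \<Rightarrow> 'h) \<Rightarrow> bool"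
  where "woven_frames I \<phi> \<psi> \<longleftrightarrow> is_frame I \<phi> \<and> is_frame I \<psi> \<and>
    (\<exists>A B. \<forall>\<sigma>\<subseteq>I. frame_with_bounds I (weaving \<sigma> \<phi> \<psi>) A B)"

definition alternate_dual_frame ::
    "'i set \<Rightarrow> 'i set \<Rightarrow> ('i \<Rightarrow> 'h::complex_hilbert) \<Rightarrow> ('i \<Rightarrow> 'h) \<Rightarrow> ('i \<Rightarrow> 'h) \<Rightarrow> bool"
  where "alternate_dual_frame I \<sigma> \<phi> \<psi> \<phi>' \<longleftrightarrow> is_frame I \<phi>' \<and>
    (\<forall>f. (\<lambda>i. cinner f (\<phi> i) *\<^sub>C \<phi>' i) summable_on \<sigma> \<and>
         (\<lambda>i. cinner f (\<psi> i) *\<^sub>C \<phi>' i) summable_on (I - \<sigma>) \<and>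
         f = (\<Sum>\<^sub>\<infinity>i\<in>\<sigma>. cinner f (\<phi> i) *\<^sub>C \<phi>' i) + (\<Sum>\<^sub>\<infinity>i\<in>I - \<sigma>. cinner f (\<psi> i) *\<^sub>C \<phi>' i))"

end

(* Duality and the convergence of the two synthesis series give a splitting f = x + y with
   x = \<Sum>\<^sub>\<sigma> \<langle>f, \<phi>'\<^sub>i\<rangle> \<phi>\<^sub>i and y = \<Sum>\<^sub>I\<^sub>-\<^sub>\<sigma> \<langle>f, \<phi>'\<^sub>i\<rangle> \<psi>\<^sub>i, and the scalar sums are \<langle>x, f\<rangle> and \<langle>y, f\<rangle>.
   The equality expands to \<bar>x\<bar>\<^sup>2 + Re \<langle>x, y\<rangle> + \<bar>y\<bar>\<^sup>2 on both sides, and in the inequality the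
   difference of the two sides is \<bar>x - l f\<bar>\<^sup>2. *)
theory Submission
  imports Defs
begin

text \<open>Registering the class as \<open>banach\<close> lets the Cauchy criterion proved below
  for Banach spaces apply to Hilbert-valued series.\<close>

instance complex_hilbert \<subseteq> banach ..

section \<open>Sesquilinearity, Cauchy-Schwarz and continuity of the inner product\<close>

lemma cinner_add_right: "cinner x (y + z) = cinner x y + cinner x z"
  by (metis cinner_add_left cinner_commute complex_cnj_add)

lemma cinner_scaleC_right: "cinner x (a *\<^sub>C y) = cnj a * cinner x y"
  by (metis cinner_commute cinner_scaleC_left complex_cnj_mult)

lemma cinner_scaleR_left: "cinner (r *\<^sub>R x) y = r *\<^sub>R cinner x y"
  by (metis cinner_scaleC_left scaleC_of_real scaleR_conv_of_real)

lemma cinner_scaleR_right: "cinner x (r *\<^sub>R y) = r *\<^sub>R cinner x y"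
  by (metis cinner_scaleC_right complex_cnj_complex_of_real scaleC_of_real scaleR_conv_of_real)

lemma cinner_zero_left [simp]: "cinner 0 y = 0"
  using cinner_add_left [of 0 0 y] by simp

lemma cinner_zero_right [simp]: "cinner x 0 = 0"
  using cinner_add_right [of x 0 0] by simp

lemma cinner_sum_left: "cinner (\<Sum>i\<in>A. f i) y = (\<Sum>i\<in>A. cinner (f i) y)"
  by (induction A rule: infinite_finite_induct) (simp_all add: cinner_add_left)

lemma norm_add_square:
  fixes x y :: "'a::complex_inner"
  shows "(norm (x + y))\<^sup>2 = (norm x)\<^sup>2 + 2 * Re (cinner x y) + (norm y)\<^sup>2"
proof -
  have "Re (cinner y x) = Re (cinner x y)"
    by (metis cinner_commute cnj.simps(1))
  moreover have "(norm z)\<^sup>2 = Re (cinner z z)" for z :: 'a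
    by (simp add: cinner_self)
  ultimately show ?thesis
    by (simp add: cinner_add_left cinner_add_right)
qed

lemma cinner_Cauchy_Schwarz:
  fixes x y :: "'a::complex_inner"
  shows "cmod (cinner x y) \<le> norm x * norm y"
proof (cases "y = 0")
  case False
  define c where "c = cinner x y"
  \<comment> \<open>With this \<open>t\<close>, \<open>x + t *\<^sub>C y\<close> is the component of
    \<open>x\<close> orthogonal to \<open>y\<close>; nonnegativity of its squared norm is the
    inequality.\<close>
  define t where "t = - (c / complex_of_real ((norm y)\<^sup>2))"
  have ny: "(norm y)\<^sup>2 > 0"
    using False by simp
  have scale: "(norm (t *\<^sub>C y))\<^sup>2 = (cmod t)\<^sup>2 * (norm y)\<^sup>2"
  proof -
    have "complex_of_real ((norm (t *\<^sub>C y))\<^sup>2) = cinner (t *\<^sub>C y) (t *\<^sub>C y)"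
      by (rule cinner_self [symmetric])
    also have "\<dots> = t * (cnj t * cinner y y)"
      by (simp only: cinner_scaleC_left cinner_scaleC_right mult.left_commute)
    also have "\<dots> = complex_of_real ((cmod t)\<^sup>2 * (norm y)\<^sup>2)"
      unfolding of_real_mult complex_norm_square cinner_self by (rule mult.assoc [symmetric])
    finally show ?thesis
      using of_real_eq_iff by blast
  qed
  have "cnj t * c = complex_of_real (- ((cmod c)\<^sup>2 / (norm y)\<^sup>2))"
    by (simp add: t_def complex_norm_square mult.commute del: of_real_power)
  then have cross: "Re (cinner x (t *\<^sub>C y)) = - ((cmod c)\<^sup>2 / (norm y)\<^sup>2)"
    by (simp add: cinner_scaleC_right flip: c_def)
  have "cmod t = cmod c / (norm y)\<^sup>2"
    by (simp add: t_def norm_divide norm_power)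
  then have "(cmod t)\<^sup>2 * (norm y)\<^sup>2 = (cmod c)\<^sup>2 / (norm y)\<^sup>2"
    using ny by (simp add: power_divide power2_eq_square)
  then have "0 \<le> (norm x)\<^sup>2 - (cmod c)\<^sup>2 / (norm y)\<^sup>2"
    using norm_add_square [of x "t *\<^sub>C y"] scale cross zero_le_power2 [of "norm (x + t *\<^sub>C y)"]
    by linarith
  then have "(cmod c)\<^sup>2 \<le> (norm x * norm y)\<^sup>2"
    using ny by (simp add: field_simps)
  then show ?thesis
    unfolding c_def by (rule power2_le_imp_le) simp
qed simp

lemma bounded_linear_cinner_left: "bounded_linear (\<lambda>x. cinner x y)"
  by (rule bounded_linear_intro [where K = "norm y"])
    (simp_all add: cinner_add_left cinner_scaleR_left cinner_Cauchy_Schwarz)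

text \<open>Conjugate linearity in the second argument is still linearity over the reals, so
  infinite sums can be moved through either slot.\<close>

lemma bounded_linear_cinner_right: "bounded_linear (cinner x)"
proof (rule bounded_linear_intro [where K = "norm x"])
  show "norm (cinner x y) \<le> norm y * norm x" for y
    using cinner_Cauchy_Schwarz [of x y] by (simp only: mult.commute)
qed (simp_all add: cinner_add_right cinner_scaleR_right)

section \<open>Cauchy criterion for unconditional sums\<close>

lemma summable_on_CauchyI:
  fixes f :: "'i \<Rightarrow> 'a::banach"
  assumes small: "\<And>e. e > 0 \<Longrightarrow> \<exists>F. finite F \<and> F \<subseteq> A \<and>
    (\<forall>G. finite G \<longrightarrow> G \<subseteq> A - F \<longrightarrow> norm (sum f G) < e)"
  shows "f summable_on A"
proof -
  have "\<exists>P. eventually P (finite_subsets_at_top A) \<and>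
          (\<forall>G G'. P G \<and> P G' \<longrightarrow> dist (sum f G) (sum f G') < e)" if "e > 0" for e
  proof -
    obtain F where F: "finite F" "F \<subseteq> A"
      and tail: "\<And>G. finite G \<Longrightarrow> G \<subseteq> A - F \<Longrightarrow> norm (sum f G) < e / 2"
      using small [OF half_gt_zero [OF \<open>e > 0\<close>]] by blast
    \<comment> \<open>Finite sums over sets containing the head \<open>F\<close> differ from
      \<open>sum f F\<close> by a tail of norm below \<open>e / 2\<close>, so any two of them are
      within \<open>e\<close>.\<close>
    define P where "P G \<longleftrightarrow> finite G \<and> F \<subseteq> G \<and> G \<subseteq> A" for G
    have "eventually P (finite_subsets_at_top A)"
      using F by (auto simp: P_def eventually_finite_subsets_at_top)
    moreover have "dist (sum f G) (sum f G') < e" if "P G" "P G'" for G G'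
    proof -
      have near: "dist (sum f H) (sum f F) < e / 2" if "P H" for H
      proof -
        have "dist (sum f H) (sum f F) = norm (sum f (H - F))"
          using that by (simp add: P_def dist_norm sum_diff)
        also have "\<dots> < e / 2"
          using that by (intro tail) (auto simp: P_def)
        finally show ?thesis .
      qed
      show ?thesis
        using near [OF \<open>P G\<close>] near [OF \<open>P G'\<close>] by (rule dist_triangle_half_l)
    qed
    ultimately show ?thesis
      by blast
  qed
  \<comment> \<open>Completeness turns the Cauchy net of finite partial sums into a convergent one,
    which is what \<open>summable_on\<close> asks for.\<close>
  then have "cauchy_filter (filtermap (sum f) (finite_subsets_at_top A))"
    by (simp add: cauchy_filter_metric_filtermap)
  then obtain L where "(sum f \<longlongrightarrow> L) (finite_subsets_at_top A)"
    using complete_uniform [where S = "UNIV :: 'a set"] complete_UNIV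
    by (force simp: filterlim_def)
  then show ?thesis
    using summable_on_def has_sum_def by blast
qed

lemma summable_on_small_tail:
  fixes g :: "'i \<Rightarrow> real"
  assumes g: "g summable_on A" and e: "e > 0"
  obtains F where "finite F" "F \<subseteq> A" "\<And>G. finite G \<Longrightarrow> G \<subseteq> A - F \<Longrightarrow> \<bar>sum g G\<bar> < e"
proof -
  have "(sum g \<longlongrightarrow> infsum g A) (finite_subsets_at_top A)"
    using g has_sum_def has_sum_infsum by blast
  then have "eventually (\<lambda>F. dist (sum g F) (infsum g A) < e / 2) (finite_subsets_at_top A)"
    using half_gt_zero [OF e] by (rule tendstoD)
  then obtain F where F: "finite F" "F \<subseteq> A"
    and near: "\<And>G. finite G \<Longrightarrow> F \<subseteq> G \<Longrightarrow> G \<subseteq> A \<Longrightarrow> dist (sum g G) (infsum g A) < e / 2"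
    by (auto simp: eventually_finite_subsets_at_top)
  \<comment> \<open>Both \<open>F\<close> and \<open>F \<union> G\<close> contain \<open>F\<close>,
    so both partial sums lie within \<open>e / 2\<close> of the limit, and their difference is the
    sum over \<open>G\<close>.\<close>
  have "\<bar>sum g G\<bar> < e" if G: "finite G" "G \<subseteq> A - F" for G
  proof -
    have "sum g (F \<union> G) = sum g F + sum g G"
      using F G by (intro sum.union_disjoint) auto
    moreover have "dist (sum g (F \<union> G)) (sum g F) < e"
    proof (rule dist_triangle_half_l)
      show "dist (sum g (F \<union> G)) (infsum g A) < e / 2"
        using F G by (intro near) auto
      show "dist (sum g F) (infsum g A) < e / 2"
        using F by (intro near) auto
    qed
    ultimately show ?thesis
      by (simp add: dist_real_def)
  qed
  with F show thesis
    using that by blast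
qed

section \<open>Synthesis series of Bessel families and frames\<close>

lemma Bessel_synthesis_bound:
  fixes \<phi> :: "'i \<Rightarrow> 'h::complex_inner"
  assumes bessel: "\<And>h. (\<Sum>i\<in>F. (cmod (cinner h (\<phi> i)))\<^sup>2) \<le> B * (norm h)\<^sup>2"
    and B: "B \<ge> 0"
  shows "(norm (\<Sum>i\<in>F. c i *\<^sub>C \<phi> i))\<^sup>2 \<le> B * (\<Sum>i\<in>F. (cmod (c i))\<^sup>2)"
proof (cases "(\<Sum>i\<in>F. c i *\<^sub>C \<phi> i) = 0")
  case True
  then show ?thesis
    using B by (simp add: sum_nonneg)
next
  case False
  define v where "v = (\<Sum>i\<in>F. c i *\<^sub>C \<phi> i)"
  have nv: "(norm v)\<^sup>2 > 0"
    using False by (simp add: v_def)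
  have flip: "cmod (cinner (\<phi> i) v) = cmod (cinner v (\<phi> i))" for i
    by (metis cinner_commute complex_mod_cnj)
  \<comment> \<open>Duality argument: expanding one copy of \<open>v\<close> produces the analysis
    coefficients of the other, which the Bessel bound controls. After Cauchy-Schwarz one factor
    \<open>(norm v)\<^sup>2\<close> cancels, which is why \<open>v = 0\<close> is treated
    separately.\<close>
  have "(norm v)\<^sup>2 = cmod (cinner v v)"
    by (simp add: cinner_self norm_power)
  also have "\<dots> = cmod (\<Sum>i\<in>F. c i * cinner (\<phi> i) v)"
    by (subst (1) v_def) (simp add: cinner_sum_left cinner_scaleC_left)
  also have "\<dots> \<le> (\<Sum>i\<in>F. cmod (c i) * cmod (cinner v (\<phi> i)))"
    by (rule order_trans [OF norm_sum]) (simp add: norm_mult flip)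
  finally have "((norm v)\<^sup>2)\<^sup>2 \<le> (\<Sum>i\<in>F. cmod (c i) * cmod (cinner v (\<phi> i)))\<^sup>2"
    by (rule power_mono) simp
  also have "\<dots> \<le> (\<Sum>i\<in>F. (cmod (c i))\<^sup>2) * (\<Sum>i\<in>F. (cmod (cinner v (\<phi> i)))\<^sup>2)"
    by (rule Cauchy_Schwarz_ineq_sum)
  also have "\<dots> \<le> (\<Sum>i\<in>F. (cmod (c i))\<^sup>2) * (B * (norm v)\<^sup>2)"
    by (intro mult_left_mono bessel sum_nonneg) simp
  finally have "(norm v)\<^sup>2 * (norm v)\<^sup>2 \<le> (B * (\<Sum>i\<in>F. (cmod (c i))\<^sup>2)) * (norm v)\<^sup>2"
    by (simp add: power2_eq_square mult_ac)
  then show ?thesis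
    using nv unfolding v_def by (rule mult_right_le_imp_le)
qed

text \<open>Square-summable coefficients have small tails, and the finite synthesis bound passes
  this on to the vectors at the cost of a factor \<open>B\<close>; hence the threshold
  \<open>e\<^sup>2 / B\<close> for the scalar tail.\<close>

lemma Bessel_synthesis_summable:
  fixes \<phi> :: "'i \<Rightarrow> 'h::complex_hilbert"
  assumes bessel: "\<And>F h. finite F \<Longrightarrow> F \<subseteq> A \<Longrightarrow>
      (\<Sum>i\<in>F. (cmod (cinner h (\<phi> i)))\<^sup>2) \<le> B * (norm h)\<^sup>2"
    and B: "B > 0"
    and c: "(\<lambda>i. (cmod (c i))\<^sup>2) summable_on A"
  shows "(\<lambda>i. c i *\<^sub>C \<phi> i) summable_on A"
proof (rule summable_on_CauchyI)
  fix e :: real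
  assume e: "e > 0"
  then have "e\<^sup>2 / B > 0"
    using B by simp
  then obtain F where F: "finite F" "F \<subseteq> A"
    and tail: "\<And>G. finite G \<Longrightarrow> G \<subseteq> A - F \<Longrightarrow> \<bar>\<Sum>i\<in>G. (cmod (c i))\<^sup>2\<bar> < e\<^sup>2 / B"
    using summable_on_small_tail [OF c] by blast
  have "norm (\<Sum>i\<in>G. c i *\<^sub>C \<phi> i) < e" if G: "finite G" "G \<subseteq> A - F" for G
  proof -
    have "(norm (\<Sum>i\<in>G. c i *\<^sub>C \<phi> i))\<^sup>2 \<le> B * (\<Sum>i\<in>G. (cmod (c i))\<^sup>2)"
      using G B by (intro Bessel_synthesis_bound bessel) auto
    also have "\<dots> < e\<^sup>2"
      using abs_less_iff [THEN iffD1, OF tail [OF G]] B by (simp add: pos_less_divide_eq mult.commute)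
    finally show ?thesis
      using e by (simp add: power2_less_imp_less)
  qed
  with F show "\<exists>F. finite F \<and> F \<subseteq> A \<and>
      (\<forall>G. finite G \<longrightarrow> G \<subseteq> A - F \<longrightarrow> norm (\<Sum>i\<in>G. c i *\<^sub>C \<phi> i) < e)"
    by blast
qed

text \<open>The definition of an alternate dual asserts convergence only of series in the dual
  vectors. This supplies convergence of the series in the frame vectors, without which
  \<open>infsum\<close> would take its default value 0. The subset \<open>A\<close> allows the two
  halves of a weaving to be handled separately.\<close>

lemma frame_synthesis_summable:
  fixes \<phi> :: "'i \<Rightarrow> 'h::complex_hilbert"
  assumes \<phi>: "is_frame I \<phi>" and A: "A \<subseteq> I" and c: "(\<lambda>i. (cmod (c i))\<^sup>2) summable_on I"
  shows "(\<lambda>i. c i *\<^sub>C \<phi> i) summable_on A"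
proof -
  obtain B where B: "B > 0"
    and summable: "\<And>h. (\<lambda>i. (cmod (cinner h (\<phi> i)))\<^sup>2) summable_on I"
    and upper: "\<And>h. (\<Sum>\<^sub>\<infinity>i\<in>I. (cmod (cinner h (\<phi> i)))\<^sup>2) \<le> B * (norm h)\<^sup>2"
    using \<phi> unfolding is_frame_def frame_with_bounds_def by blast
  show ?thesis
  proof (rule Bessel_synthesis_summable [OF _ B])
    fix F h
    assume "finite F" "F \<subseteq> A"
    then have "(\<Sum>i\<in>F. (cmod (cinner h (\<phi> i)))\<^sup>2) \<le> (\<Sum>\<^sub>\<infinity>i\<in>I. (cmod (cinner h (\<phi> i)))\<^sup>2)"
      using A summable by (intro finite_sum_le_infsum) auto
    then show "(\<Sum>i\<in>F. (cmod (cinner h (\<phi> i)))\<^sup>2) \<le> B * (norm h)\<^sup>2"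
      using upper by (rule order_trans)
  qed (use c A summable_on_subset_banach in blast)
qed

section \<open>Pairing synthesis series with a fixed vector\<close>

lemma cinner_synthesis:
  assumes "(\<lambda>i. c i *\<^sub>C \<phi> i) summable_on A"
  shows "cinner (\<Sum>\<^sub>\<infinity>i\<in>A. c i *\<^sub>C \<phi> i) g = (\<Sum>\<^sub>\<infinity>i\<in>A. c i * cnj (cinner g (\<phi> i)))"
proof -
  have "((\<lambda>i. cinner (c i *\<^sub>C \<phi> i) g) has_sum cinner (\<Sum>\<^sub>\<infinity>i\<in>A. c i *\<^sub>C \<phi> i) g) A"
    using assms by (intro has_sum_bounded_linear [OF bounded_linear_cinner_left] has_sum_infsum)
  moreover have "cinner (c i *\<^sub>C \<phi> i) g = c i * cnj (cinner g (\<phi> i))" for i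
    by (metis cinner_commute cinner_scaleC_left)
  ultimately show ?thesis
    by (simp add: infsumI)
qed

lemma cinner_synthesis_right:
  assumes "(\<lambda>i. c i *\<^sub>C \<phi> i) summable_on A"
  shows "cinner f (\<Sum>\<^sub>\<infinity>i\<in>A. c i *\<^sub>C \<phi> i) = (\<Sum>\<^sub>\<infinity>i\<in>A. cinner f (\<phi> i) * cnj (c i))"
proof -
  have "((\<lambda>i. cinner f (c i *\<^sub>C \<phi> i)) has_sum cinner f (\<Sum>\<^sub>\<infinity>i\<in>A. c i *\<^sub>C \<phi> i)) A"
    using assms by (intro has_sum_bounded_linear [OF bounded_linear_cinner_right] has_sum_infsum)
  then show ?thesis
    by (simp add: infsumI cinner_scaleC_right mult.commute)
qed

text \<open>Testing against \<open>g = x - y\<close> shows that the difference has norm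
  zero.\<close>

lemma cinner_left_ext:
  assumes "\<And>g. cinner x g = cinner y g"
  shows "x = y"
proof -
  have "cinner (x - y) (x - y) + cinner y (x - y) = cinner x (x - y)"
    by (simp flip: cinner_add_left)
  then have "cinner (x - y) (x - y) = 0"
    by (simp add: assms)
  then show ?thesis
    by (simp add: cinner_self)
qed

section \<open>Algebra of a two-term splitting, and the theorem\<close>

lemma splitting_identity:
  fixes x y :: "'a::complex_inner"
  shows "Re (cinner x (x + y)) + (norm y)\<^sup>2 = Re (cinner y (x + y)) + (norm x)\<^sup>2"
    and "Re (cinner y (x + y)) + (norm x)\<^sup>2 - (2 * l - l\<^sup>2) * Re (cinner x (x + y))
      - (1 - l\<^sup>2) * Re (cinner y (x + y)) = (norm (x - l *\<^sub>R (x + y)))\<^sup>2"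
proof -
  have comm: "Re (cinner y x) = Re (cinner x y)"
    by (metis cinner_commute cnj.simps(1))
  have self: "Re (cinner z z) = (norm z)\<^sup>2" for z :: 'a
    by (simp add: cinner_self)
  show "Re (cinner x (x + y)) + (norm y)\<^sup>2 = Re (cinner y (x + y)) + (norm x)\<^sup>2"
    by (simp add: cinner_add_right comm self)
  \<comment> \<open>Collecting the multiples of \<open>x\<close> and \<open>y\<close> prepares for
    \<open>norm_add_square\<close>. The simp rule deleted below would pull the sign out of
    \<open>- l\<close>, which has to remain a scalar factor.\<close>
  have "x - l *\<^sub>R (x + y) = (1 - l) *\<^sub>R x + (- l) *\<^sub>R y"
    by (simp add: algebra_simps)
  then have "(norm (x - l *\<^sub>R (x + y)))\<^sup>2
      = (1 - l)\<^sup>2 * (norm x)\<^sup>2 + 2 * (1 - l) * (- l) * Re (cinner x y) + l\<^sup>2 * (norm y)\<^sup>2"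
    by (simp add: norm_add_square cinner_scaleR_left cinner_scaleR_right power_mult_distrib
        del: scaleR_minus_left)
  then show "Re (cinner y (x + y)) + (norm x)\<^sup>2 - (2 * l - l\<^sup>2) * Re (cinner x (x + y))
      - (1 - l\<^sup>2) * Re (cinner y (x + y)) = (norm (x - l *\<^sub>R (x + y)))\<^sup>2"
    by (simp add: cinner_add_right comm self power2_eq_square algebra_simps)
qed

theorem theorem9:
  fixes I \<sigma> :: "'i set"
    and \<phi> \<psi> \<phi>' :: "'i \<Rightarrow> 'h::complex_hilbert"
    and l :: real
    and f :: 'h
  assumes "separable_space (euclidean :: 'h topology)"
    and "countable I"
    and "woven_frames I \<phi> \<psi>"
    and "\<sigma> \<subseteq> I"
    and "alternate_dual_frame I \<sigma> \<phi> \<psi> \<phi>'"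
  shows "Re (\<Sum>\<^sub>\<infinity>i\<in>\<sigma>. cinner f (\<phi>' i) * cnj (cinner f (\<phi> i)))
           + (norm (\<Sum>\<^sub>\<infinity>i\<in>I - \<sigma>. cinner f (\<phi>' i) *\<^sub>C \<psi> i))\<^sup>2
         = Re (\<Sum>\<^sub>\<infinity>i\<in>I - \<sigma>. cinner f (\<phi>' i) * cnj (cinner f (\<psi> i)))
           + (norm (\<Sum>\<^sub>\<infinity>i\<in>\<sigma>. cinner f (\<phi>' i) *\<^sub>C \<phi> i))\<^sup>2
       \<and> Re (\<Sum>\<^sub>\<infinity>i\<in>I - \<sigma>. cinner f (\<phi>' i) * cnj (cinner f (\<psi> i)))
           + (norm (\<Sum>\<^sub>\<infinity>i\<in>\<sigma>. cinner f (\<phi>' i) *\<^sub>C \<phi> i))\<^sup>2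
         \<ge> (2 * l - l\<^sup>2) * Re (\<Sum>\<^sub>\<infinity>i\<in>\<sigma>. cinner f (\<phi>' i) * cnj (cinner f (\<phi> i)))
           + (1 - l\<^sup>2) * Re (\<Sum>\<^sub>\<infinity>i\<in>I - \<sigma>. cinner f (\<phi>' i) * cnj (cinner f (\<psi> i)))"
proof -
  define c where "c i = cinner f (\<phi>' i)" for i
  define x where "x = (\<Sum>\<^sub>\<infinity>i\<in>\<sigma>. c i *\<^sub>C \<phi> i)"
  define y where "y = (\<Sum>\<^sub>\<infinity>i\<in>I - \<sigma>. c i *\<^sub>C \<psi> i)"
  \<comment> \<open>An alternate dual is itself a frame, so its analysis coefficients of
    \<open>f\<close> are square-summable.\<close>
  have c: "(\<lambda>i. (cmod (c i))\<^sup>2) summable_on I"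
    using assms(5)
    unfolding alternate_dual_frame_def is_frame_def frame_with_bounds_def c_def by blast
  have \<phi>: "is_frame I \<phi>" and \<psi>: "is_frame I \<psi>"
    using assms(3) by (auto simp: woven_frames_def)
  have x: "cinner x g = (\<Sum>\<^sub>\<infinity>i\<in>\<sigma>. c i * cnj (cinner g (\<phi> i)))" for g
    unfolding x_def by (intro cinner_synthesis frame_synthesis_summable [OF \<phi> assms(4) c])
  have y: "cinner y g = (\<Sum>\<^sub>\<infinity>i\<in>I - \<sigma>. c i * cnj (cinner g (\<psi> i)))" for g
    unfolding y_def by (intro cinner_synthesis frame_synthesis_summable [OF \<psi> _ c]) auto
  \<comment> \<open>The hypothesis reconstructs \<open>g\<close> from the vectors
    \<open>\<phi>' i\<close>, while \<open>x + y\<close> is built from \<open>\<phi> i\<close> and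
    \<open>\<psi> i\<close>. Applying \<open>cinner f\<close> to the expansion of \<open>g\<close>
    exchanges the two roles, and the resulting scalar series are those of \<open>cinner x g\<close>
    and \<open>cinner y g\<close>.\<close>
  have "cinner (x + y) g = cinner f g" for g
  proof -
    have sum1: "(\<lambda>i. cinner g (\<phi> i) *\<^sub>C \<phi>' i) summable_on \<sigma>"
      and sum2: "(\<lambda>i. cinner g (\<psi> i) *\<^sub>C \<phi>' i) summable_on (I - \<sigma>)"
      and dual: "g = (\<Sum>\<^sub>\<infinity>i\<in>\<sigma>. cinner g (\<phi> i) *\<^sub>C \<phi>' i) + (\<Sum>\<^sub>\<infinity>i\<in>I - \<sigma>. cinner g (\<psi> i) *\<^sub>C \<phi>' i)"
      using assms(5) unfolding alternate_dual_frame_def by blast+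
    have "cinner f g = (\<Sum>\<^sub>\<infinity>i\<in>\<sigma>. c i * cnj (cinner g (\<phi> i)))
        + (\<Sum>\<^sub>\<infinity>i\<in>I - \<sigma>. c i * cnj (cinner g (\<psi> i)))"
      by (subst dual) (simp add: cinner_add_right cinner_synthesis_right sum1 sum2 c_def)
    then show ?thesis
      by (simp add: cinner_add_left x y)
  qed
  then have f: "x + y = f"
    by (rule cinner_left_ext)
  \<comment> \<open>The scalar sums are the pairings of \<open>x\<close> and \<open>y\<close> with
    \<open>g = f\<close>, and \<open>f\<close> is written as \<open>x + y\<close> to match
    \<open>splitting_identity\<close>.\<close>
  have X: "(\<Sum>\<^sub>\<infinity>i\<in>\<sigma>. cinner f (\<phi>' i) * cnj (cinner f (\<phi> i))) = cinner x (x + y)"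
    and Y: "(\<Sum>\<^sub>\<infinity>i\<in>I - \<sigma>. cinner f (\<phi>' i) * cnj (cinner f (\<psi> i))) = cinner y (x + y)"
    by (simp_all only: f x y c_def)
  have x': "(\<Sum>\<^sub>\<infinity>i\<in>\<sigma>. cinner f (\<phi>' i) *\<^sub>C \<phi> i) = x"
    and y': "(\<Sum>\<^sub>\<infinity>i\<in>I - \<sigma>. cinner f (\<phi>' i) *\<^sub>C \<psi> i) = y"
    by (simp_all only: x_def y_def c_def)
  show ?thesis
    unfolding X Y x' y'
  proof
    show "Re (cinner x (x + y)) + (norm y)\<^sup>2 = Re (cinner y (x + y)) + (norm x)\<^sup>2"
      by (rule splitting_identity)
    show "Re (cinner y (x + y)) + (norm x)\<^sup>2 \<ge> (2 * l - l\<^sup>2) * Re (cinner x (x + y))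
        + (1 - l\<^sup>2) * Re (cinner y (x + y))"
      using splitting_identity(2) [where x = x and y = y and l = l]
        zero_le_power2 [of "norm (x - l *\<^sub>R (x + y))"]
      by linarith
  qed
qed

end
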